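(* Let $K\ge 1$ and $k=\frac{K-1}{K+1}$. Suppose that $f(z)=h(z)+\overline{g(z)}=\sum_{n=0}^\infty a_nz^n+\overline{\sum_{n=1}^\infty b_nz^n}$ is a sense-preserving $K$-quasiconformal harmonic mapping in $\mathbb{D}$ and $h\prec\phi$, where $\phi$ is univalent and convex in $\mathbb{D}$, and suppose $\lambda=d(\phi(0),\partial\phi(\mathbb{D}))\le 1$. Put $$S_1(r):=\sum_{n=1}^\infty |a_n|r^n+\sum_{n=1}^\infty |b_n|r^n+\left(\frac{1}{2-\lambda}+\frac{r}{1-r}\right)\left(\sum_{n=1}^\infty |a_n|^2r^{2n}+\sum_{n=1}^\infty |b_n|^2r^{2n}\right).$$ Then $S_1(r)\le\lambda$ for $r\le r_0$, where $r_0$ is the unique root in $\left(0,\frac{K+1}{5K+1}\right)$ of the equation $$\left(3+2\left(\frac{K-1}{K+1}\right)\right)r^3-\left(5+4\left(\frac{K-1}{K+1}\right)^2\right)r^2-\left(3+2\left(\frac{K-1}{K+1}\right)\right)r+1=0.$$ Moreover, for any $r\in\left(r_0,\frac{K+1}{5K+1}\right)$ there exists a uniquely defined $\lambda_1(r)\in(0,1)$, satisfying $G_1(\lambda_1(r),r)=0$, such that $S_1(r)\le\lambda$ whenever $\lambda\le\lambda_1(r)$ (for all sense-preserving $K$-quasiconformal harmonic mappings $f=h+\overline{g}$ in $\mathbb{D}$, with $h(z)=\sum_{n=0}^\infty a_nz^n$ and $g(z)=\sum_{n=1}^\infty b_nz^n$, and all $\phi$ univalent and convex in $\mathbb{D}$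 such that $h\prec\phi$ and $\lambda=d(\phi(0),\partial\phi(\mathbb{D}))\le 1$), where $$G_1(\lambda,r)=4(k^2+1)r^3\lambda^2-\left((7+2k+4k^2)r^3+(3+4k^2)r^2-(3+2k)r+1\right)\lambda+(6+4k)r^3-2r^2-(6+4k)r+2.$$
   Context: $\mathbb{D}=\{z\in\mathbb{C}:|z|<1\}$, and $r=|z|\in[0,1)$. A harmonic mapping in $\mathbb{D}$ is written $f=h+\overline{g}$ with $h,g$ analytic in $\mathbb{D}$. It is locally univalent and sense-preserving if $h'\neq0$ in $\mathbb{D}$ and the dilatation $\omega=g'/h'$ satisfies $|\omega|<1$ in $\mathbb{D}$. Such an $f$ is called ($K$-quasiconformal) for $K\ge1$ if $|\omega(z)|\le k<1$ for all $z\in\mathbb{D}$, where $K=(1+k)/(1-k)$, i.e. $k=(K-1)/(K+1)$. For analytic $h,\phi$ in $\mathbb{D}$, $h\prec\phi$ (subordination) means $h=\phi\circ w$ for some analytic $w:\mathbb{D}\to\mathbb{D}$ with $w(0)=0$. "Univalent and convex" means $\phi$ is analytic and injective on $\mathbb{D}$ and $\phi(\mathbb{D})$ is a convex domain. $d(\phi(0),\partial\phi(\mathbb{D}))$ is the Euclidean distance from $\phi(0)$ to the boundary of $\phi(\mathbb{D})$. *)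

theory Defs
  imports "HOL-Complex_Analysis.Complex_Analysis"
begin

abbreviation unit_disc :: "complex set" where
  "unit_disc \<equiv> ball 0 1"

definition dilatation :: "(complex \<Rightarrow> complex) \<Rightarrow> (complex \<Rightarrow> complex) \<Rightarrow> complex \<Rightarrow> complex" where
  "dilatation h g z = deriv g z / deriv h z"

definition harmonic_mapping ::
  "(complex \<Rightarrow> complex) \<Rightarrow> (complex \<Rightarrow> complex) \<Rightarrow> (complex \<Rightarrow> complex) \<Rightarrow> bool" where
  "harmonic_mapping f h g \<longleftrightarrow>
     h holomorphic_on unit_disc \<and> g holomorphic_on unit_disc \<and>
     (\<forall>z\<in>unit_disc. f z = h z + cnj (g z))"

text \<open>Local univalence is included here, through \<open>h' \<noteq> 0\<close>.\<close>

definition sense_preserving ::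
  "(complex \<Rightarrow> complex) \<Rightarrow> (complex \<Rightarrow> complex) \<Rightarrow> bool" where
  "sense_preserving h g \<longleftrightarrow>
     (\<forall>z\<in>unit_disc. deriv h z \<noteq> 0 \<and> norm (dilatation h g z) < 1)"

definition qc_harmonic_mapping ::
  "real \<Rightarrow> (complex \<Rightarrow> complex) \<Rightarrow> (complex \<Rightarrow> complex) \<Rightarrow> (complex \<Rightarrow> complex) \<Rightarrow> bool" where
  "qc_harmonic_mapping K f h g \<longleftrightarrow>
     harmonic_mapping f h g \<and> sense_preserving h g \<and>
     (\<forall>z\<in>unit_disc. norm (dilatation h g z) \<le> (K - 1) / (K + 1))"

definition has_power_series :: "(complex \<Rightarrow> complex) \<Rightarrow> (nat \<Rightarrow> complex) \<Rightarrow> bool" where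
  "has_power_series h a \<longleftrightarrow> (\<forall>z\<in>unit_disc. (\<lambda>n. a n * z ^ n) sums h z)"

definition subordinate :: "(complex \<Rightarrow> complex) \<Rightarrow> (complex \<Rightarrow> complex) \<Rightarrow> bool" where
  "subordinate h \<phi> \<longleftrightarrow>
     (\<exists>w. w holomorphic_on unit_disc \<and> w ` unit_disc \<subseteq> unit_disc \<and> w 0 = 0 \<and>
          (\<forall>z\<in>unit_disc. h z = \<phi> (w z)))"

definition univalent_convex :: "(complex \<Rightarrow> complex) \<Rightarrow> bool" where
  "univalent_convex \<phi> \<longleftrightarrow>
     \<phi> holomorphic_on unit_disc \<and> inj_on \<phi> unit_disc \<and> convex (\<phi> ` unit_disc)"

text \<open>For univalent \<open>\<phi>\<close> the frontier is nonempty (the image of the disc is not the whole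
  plane, by Liouville), so the convention \<open>infdist x {} = 0\<close> plays no role.\<close>

definition boundary_dist :: "(complex \<Rightarrow> complex) \<Rightarrow> real" where
  "boundary_dist \<phi> = infdist (\<phi> 0) (frontier (\<phi> ` unit_disc))"

text \<open>The sums start at index 1, hence the \<open>Suc n\<close>. For \<open>0 \<le> r < 1\<close> and coefficients of power
  series that converge in the disc, all four series are summable.\<close>

definition S1 :: "(nat \<Rightarrow> complex) \<Rightarrow> (nat \<Rightarrow> complex) \<Rightarrow> real \<Rightarrow> real \<Rightarrow> real" where
  "S1 a b l r =
     (\<Sum>n. norm (a (Suc n)) * r ^ Suc n) + (\<Sum>n. norm (b (Suc n)) * r ^ Suc n) +
     (1 / (2 - l) + r / (1 - r)) *
       ((\<Sum>n. (norm (a (Suc n)))\<^sup>2 * r ^ (2 * Suc n)) +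
        (\<Sum>n. (norm (b (Suc n)))\<^sup>2 * r ^ (2 * Suc n)))"

definition G1 :: "real \<Rightarrow> real \<Rightarrow> real \<Rightarrow> real" where
  "G1 k l r =
     4 * (k\<^sup>2 + 1) * r ^ 3 * l\<^sup>2
     - ((7 + 2 * k + 4 * k\<^sup>2) * r ^ 3 + (3 + 4 * k\<^sup>2) * r\<^sup>2 - (3 + 2 * k) * r + 1) * l
     + (6 + 4 * k) * r ^ 3 - 2 * r\<^sup>2 - (6 + 4 * k) * r + 2"

definition is_r0 :: "real \<Rightarrow> real \<Rightarrow> bool" where
  "is_r0 K r \<longleftrightarrow>
     0 < r \<and> r < (K + 1) / (5 * K + 1) \<and>
     (3 + 2 * ((K - 1) / (K + 1))) * r ^ 3 - (5 + 4 * ((K - 1) / (K + 1))\<^sup>2) * r\<^sup>2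
       - (3 + 2 * ((K - 1) / (K + 1))) * r + 1 = 0"

definition admissible ::
  "real \<Rightarrow> (complex \<Rightarrow> complex) \<Rightarrow> (complex \<Rightarrow> complex) \<Rightarrow> (complex \<Rightarrow> complex) \<Rightarrow>
     (nat \<Rightarrow> complex) \<Rightarrow> (nat \<Rightarrow> complex) \<Rightarrow> (complex \<Rightarrow> complex) \<Rightarrow> bool" where
  "admissible K f h g a b \<phi> \<longleftrightarrow>
     qc_harmonic_mapping K f h g \<and>
     has_power_series h a \<and> has_power_series g b \<and> b 0 = 0 \<and>
     univalent_convex \<phi> \<and> subordinate h \<phi> \<and> boundary_dist \<phi> \<le> 1"

end

theory Submission
  imports Defs
begin

text \<open>
  A supporting line at the boundary point of \<open>\<phi>(D)\<close> nearest to \<open>\<phi>(0)\<close> puts \<open>h(D)\<close> into a half plane at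
  distance \<open>\<lambda>\<close> from \<open>h(0)\<close>, so \<open>|a\<^sub>n| \<le> 2\<lambda>\<close> by Caratheodory's coefficient bound. Parseval applied to
  \<open>|g'| \<le> k|h'|\<close> gives \<open>\<Sum>|b\<^sub>n|\<^sup>2r\<^sup>2\<^sup>n \<le> k\<^sup>2\<Sum>|a\<^sub>n|\<^sup>2r\<^sup>2\<^sup>n\<close>, and Bohr's inequality for the dilatation in
  \<open>g' = \<omega>h'\<close> gives \<open>\<Sum>|b\<^sub>n|r\<^sup>n \<le> k\<Sum>|a\<^sub>n|r\<^sup>n\<close> for \<open>r \<le> 1/3\<close>; note that \<open>(K+1)/(5K+1) = 1/(3+2k) \<le> 1/3\<close>.
  Hence \<open>S\<^sub>1(r) \<le> \<lambda>M(\<lambda>,r)\<close> with \<open>M\<close> increasing in both arguments, and up to a positive factor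
  \<open>G\<^sub>1(\<lambda>,r)\<close> is \<open>1 - M(\<lambda>,r)\<close>. The cubic defining \<open>r\<^sub>0\<close> is \<open>G\<^sub>1(1,r)\<close>.
\<close>

subsection \<open>Power series in the disc\<close>

lemma has_power_series_summable:
  assumes "has_power_series f a" "0 \<le> r" "r < 1"
  shows "summable (\<lambda>n. norm (a n) * r ^ n)"
proof -
  \<comment> \<open>Convergence at a point \<open>s\<close> strictly between \<open>r\<close> and 1
    forces absolute convergence at \<open>r\<close>.\<close>
  obtain s where s: "r < s" "s < 1" using dense assms by blast
  have "summable (\<lambda>n. a n * (of_real s :: complex) ^ n)"
    using assms s by (auto simp: has_power_series_def sums_iff)
  from powser_insidea[OF this, of "of_real r"] s assms show ?thesis
    by (simp add: norm_mult norm_power)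
qed

lemma holomorphic_has_power_series:
  assumes "f holomorphic_on unit_disc"
  shows "has_power_series f (\<lambda>n. (deriv ^^ n) f 0 / fact n)"
  using holomorphic_power_series[OF assms] unfolding has_power_series_def by simp

lemma has_power_series_0:
  assumes "has_power_series f a"
  shows "f 0 = a 0"
proof -
  have "(\<lambda>n. a n * 0 ^ n) sums f 0"
    using assms unfolding has_power_series_def by (rule bspec) simp
  thus ?thesis using powser_sums_zero[of a] by (rule sums_unique2)
qed

text \<open>Brings a function with values in a half plane into the form with nonnegative real part
  that \<open>caratheodory_coeff_bound\<close> asks for. The summand \<open>d\<close> affects the
  constant coefficient only.\<close>

lemma has_power_series_affine:
  assumes "has_power_series f a"
  shows "has_power_series (\<lambda>z. d - c * f z) (\<lambda>n. (if n = 0 then d else 0) - c * a n)"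
  unfolding has_power_series_def
proof
  fix z :: complex assume "z \<in> unit_disc"
  hence "(\<lambda>n. c * (a n * z ^ n)) sums (c * f z)"
    using assms by (intro sums_mult) (auto simp: has_power_series_def)
  moreover have "(\<lambda>n. if n = 0 then d else 0) sums d"
    using sums_single[of 0 "\<lambda>_. d"] by simp
  ultimately have "(\<lambda>n. (if n = 0 then d else 0) - c * (a n * z ^ n)) sums (d - c * f z)"
    by (intro sums_diff)
  moreover have "(\<lambda>n. (if n = 0 then d else 0) - c * (a n * z ^ n)) =
      (\<lambda>n. ((if n = 0 then d else 0) - c * a n) * z ^ n)"
    by (auto simp: algebra_simps)
  ultimately show "(\<lambda>n. ((if n = 0 then d else 0) - c * a n) * z ^ n) sums (d - c * f z)" by simp
qed

lemma has_power_series_imp_fps: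
  assumes "has_power_series f a"
  shows "f has_fps_expansion Abs_fps a"
proof (rule has_fps_expansionI)
  have "eventually (\<lambda>u::complex. u \<in> unit_disc) (nhds 0)"
    by (intro eventually_nhds_in_open) auto
  thus "\<forall>\<^sub>F u in nhds 0. (\<lambda>n. fps_nth (Abs_fps a) n * u ^ n) sums f u"
    by eventually_elim (use assms in \<open>auto simp: has_power_series_def\<close>)
qed

lemma has_power_series_deriv:
  assumes "has_power_series f a"
  shows "has_power_series (deriv f) (diffs a)"
  unfolding has_power_series_def
proof
  fix z :: complex assume z: "z \<in> unit_disc"
  have sm: "summable (\<lambda>n. a n * x ^ n)" if "norm x < 1" for x
    using assms that by (auto simp: has_power_series_def sums_iff)
  have "((\<lambda>z. \<Sum>n. a n * z^n) has_field_derivative (\<Sum>n. diffs a n * z^n)) (at z)"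
    using z sm by (intro termdiffs_strong'[where K = 1]) auto
  hence "(f has_field_derivative (\<Sum>n. diffs a n * z^n)) (at z)"
    by (rule has_field_derivative_transform_within_open[where S = unit_disc])
       (use z assms in \<open>auto simp: has_power_series_def sums_iff\<close>)
  moreover have "summable (\<lambda>n. diffs a n * z^n)"
    using z by (intro termdiff_converges[where K = 1] sm) auto
  ultimately show "(\<lambda>n. diffs a n * z ^ n) sums deriv f z"
    by (simp add: DERIV_imp_deriv summable_sums)
qed

text \<open>Both \<open>c\<close> and the Cauchy product of \<open>a\<close> and \<open>b\<close>
  expand the same function at 0, and a formal power series expansion is unique.\<close>

lemma has_power_series_mult_coeff:
  assumes "has_power_series f a" "has_power_series g b" "has_power_series p c"
    and "\<And>z. z \<in> unit_disc \<Longrightarrow> p z = f z * g z"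
  shows "c n = (\<Sum>i\<le>n. a i * b (n - i))"
proof -
  have "(\<lambda>z. f z * g z) has_fps_expansion Abs_fps a * Abs_fps b"
    by (intro has_fps_expansion_mult has_power_series_imp_fps assms)
  moreover have "has_power_series (\<lambda>z. f z * g z) c"
    using assms by (auto simp: has_power_series_def)
  hence "(\<lambda>z. f z * g z) has_fps_expansion Abs_fps c" by (rule has_power_series_imp_fps)
  ultimately have "Abs_fps c = Abs_fps a * Abs_fps b" by (rule fps_expansion_unique_complex[symmetric])
  hence "fps_nth (Abs_fps c) n = fps_nth (Abs_fps a * Abs_fps b) n" by simp
  thus ?thesis by (simp add: fps_mult_nth atLeast0AtMost)
qed

subsection \<open>Integrals over circles\<close>

text \<open>The parameter runs over [0,1], so that integrals over \<open>{0..1}\<close> are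
  normalised means over the circle and no factor 1/(2 pi) appears.\<close>

definition circle_pt :: "real \<Rightarrow> complex" where "circle_pt t = cis (2 * pi * t)"

lemma norm_circle_pt [simp]: "norm (circle_pt t) = 1"
  and continuous_on_circle_pt [continuous_intros]: "continuous_on S circle_pt"
  unfolding circle_pt_def by (auto intro!: continuous_intros)

lemma circle_pt_mult_cnj [simp]: "circle_pt t * cnj (circle_pt t) = 1"
  by (simp add: circle_pt_def cis_cnj cis_mult)

text \<open>The integrand is an exponential whose antiderivative takes the same value at both ends
  of [0,1], by periodicity.\<close>

lemma integral_circle_pt_power:
  assumes "m > 0"
  shows "integral {0..1} (\<lambda>t. circle_pt t ^ m) = 0"
proof -
  have c: "circle_pt t ^ m = exp (of_real t * (2 * pi * \<i> * m))" for t
    by (simp add: circle_pt_def cis_conv_exp flip: exp_of_nat_mult) (simp add: algebra_simps)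
  let ?F = "\<lambda>t. exp (of_real t * (2 * pi * \<i> * m)) / (2 * pi * \<i> * m)"
  have "((\<lambda>t. exp (of_real t * (2 * pi * \<i> * m))) has_integral ?F 1 - ?F 0) {0..1}"
  proof (rule fundamental_theorem_of_calculus)
    fix x :: real assume "x \<in> {0..1}"
    have "((\<lambda>z. exp (z * (2 * pi * \<i> * m)) / (2 * pi * \<i> * m)) has_field_derivative
        exp (of_real x * (2 * pi * \<i> * m))) (at (of_real x))"
      using assms by (auto intro!: derivative_eq_intros)
    from has_vector_derivative_real_field[OF this]
    show "(?F has_vector_derivative exp (of_real x * (2 * pi * \<i> * m))) (at x within {0..1})" .
  qed auto
  moreover have "?F 1 - ?F 0 = 0"
    using exp_integer_2pi[of "of_nat m"] by (simp add: mult_ac)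
  ultimately show ?thesis unfolding c by (simp add: integral_unique)
qed

text \<open>On the unit circle the conjugate is the inverse, so for \<open>m < n\<close> the
  integrand is a positive power of \<open>circle_pt\<close>. The case \<open>n < m\<close> follows
  by conjugation.\<close>

lemma integral_circle_pt_orthogonal:
  "integral {0..1} (\<lambda>t. circle_pt t ^ n * cnj (circle_pt t) ^ m) = (if n = m then 1 else 0)"
proof -
  have *: "integral {0..1} (\<lambda>t. circle_pt t ^ n * cnj (circle_pt t) ^ m) = 0" if "m < n" for n m
  proof -
    have "circle_pt t ^ n * cnj (circle_pt t) ^ m = circle_pt t ^ (n - m)" for t
    proof -
      have "circle_pt t ^ n = circle_pt t ^ (n - m) * circle_pt t ^ m"
        using that by (simp flip: power_add)
      thus ?thesis by (simp add: mult.assoc flip: power_mult_distrib)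
    qed
    thus ?thesis using integral_circle_pt_power[of "n - m"] that by simp
  qed
  consider "n = m" | "m < n" | "n < m" by linarith
  thus ?thesis
  proof cases
    case 1
    thus ?thesis by (simp flip: power_mult_distrib)
  next
    case 2
    thus ?thesis using * by simp
  next
    case 3
    have "integral {0..1} (\<lambda>t. circle_pt t ^ n * cnj (circle_pt t) ^ m) =
        cnj (integral {0..1} (\<lambda>t. circle_pt t ^ m * cnj (circle_pt t) ^ n))"
      by (subst integral_cnj) (simp add: mult.commute)
    thus ?thesis using * 3 by simp
  qed
qed

lemma circle_in_disc: "0 \<le> r \<Longrightarrow> r < 1 \<Longrightarrow> of_real r * circle_pt t \<in> unit_disc"
  by (simp add: norm_mult)

lemma has_power_series_continuous:
  assumes "has_power_series f a"
  shows "continuous_on unit_disc f"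
proof -
  have sm: "summable (\<lambda>n. a n * x ^ n)" if "norm x < 1" for x
    using assms that by (auto simp: has_power_series_def sums_iff)
  have "continuous_on unit_disc (\<lambda>z. \<Sum>n. a n * z^n)"
    by (intro continuous_at_imp_continuous_on ballI DERIV_isCont[OF termdiffs_strong'[where K = 1]])
      (auto intro: sm)
  thus ?thesis
    by (rule continuous_on_eq) (use assms in \<open>auto simp: has_power_series_def sums_iff\<close>)
qed

lemma continuous_on_circle:
  assumes "has_power_series f a" "0 \<le> r" "r < 1"
  shows "continuous_on S (\<lambda>t. f (of_real r * circle_pt t))"
  by (intro continuous_on_compose2[OF has_power_series_continuous[OF assms(1)]] continuous_intros)
     (use assms circle_in_disc in auto)

text \<open>On a circle of radius \<open>r < 1\<close> the power series converges uniformly by the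
  Weierstrass test, so it may be integrated term by term against any continuous \<open>u\<close>.
  Powers of \<open>circle_pt\<close> and of its conjugate, as well as the conjugate of
  \<open>f\<close> itself, will be inserted for \<open>u\<close>.\<close>

lemma circle_sums:
  assumes f: "has_power_series f a" and r: "0 \<le> r" "r < 1" and u: "continuous_on {0..1} u"
  shows "(\<lambda>n. a n * of_real r ^ n * integral {0..1} (\<lambda>t. circle_pt t ^ n * u t))
           sums integral {0..1} (\<lambda>t. f (of_real r * circle_pt t) * u t)"
proof -
  have "bounded (u ` {0..1})" by (intro compact_imp_bounded compact_continuous_image u) simp
  then obtain B where "\<forall>x\<in>u ` {0..1}. norm x \<le> B" unfolding bounded_iff ..
  hence B: "norm (u t) \<le> B" if "t \<in> {0..1}" for t using that by blast
  let ?g = "\<lambda>n t. a n * of_real r ^ n * (circle_pt t ^ n * u t)"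
  have "uniform_limit {0..1} (\<lambda>N t. \<Sum>n<N. ?g n t) (\<lambda>t. \<Sum>n. ?g n t) sequentially"
  proof (rule Weierstrass_m_test)
    show "norm (?g n t) \<le> norm (a n) * r ^ n * B" if "t \<in> {0..1}" for n t
      using B[OF that] r by (simp add: norm_mult norm_power mult_left_mono)
    show "summable (\<lambda>n. norm (a n) * r ^ n * B)"
      by (intro summable_mult2 has_power_series_summable[OF f r])
  qed
  moreover have "(\<Sum>n. ?g n t) = f (of_real r * circle_pt t) * u t" for t
  proof -
    have "(\<lambda>n. a n * (of_real r * circle_pt t) ^ n * u t) sums (f (of_real r * circle_pt t) * u t)"
      using f circle_in_disc[OF r] by (intro sums_mult2) (auto simp: has_power_series_def)
    thus ?thesis by (simp add: sums_iff power_mult_distrib mult_ac)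
  qed
  ultimately have lim: "uniform_limit {0..1} (\<lambda>N t. \<Sum>n<N. ?g n t)
      (\<lambda>t. f (of_real r * circle_pt t) * u t) sequentially" by simp
  have cont: "continuous_on {0..1} (?g n)" for n by (intro continuous_intros u)
  obtain I J where IJ: "\<And>N. ((\<lambda>t. \<Sum>n<N. ?g n t) has_integral I N) {0..1}"
     "((\<lambda>t. f (of_real r * circle_pt t) * u t) has_integral J) {0..1}" "I \<longlonglongrightarrow> J"
    by (rule uniform_limit_integral[OF lim]) (auto intro!: continuous_intros u)
  have "I N = (\<Sum>n<N. a n * of_real r ^ n * integral {0..1} (\<lambda>t. circle_pt t ^ n * u t))" for N
  proof -
    have "I N = integral {0..1} (\<lambda>t. \<Sum>n<N. ?g n t)" by (rule integral_unique[OF IJ(1), symmetric])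
    also have "\<dots> = (\<Sum>n<N. integral {0..1} (?g n))"
      by (intro integral_sum integrable_continuous_real cont) auto
    finally show ?thesis by simp
  qed
  hence "I = (\<lambda>N. \<Sum>n<N. a n * of_real r ^ n * integral {0..1} (\<lambda>t. circle_pt t ^ n * u t))"
    by (rule ext)
  thus ?thesis using IJ(2,3) unfolding sums_def by (simp add: integral_unique)
qed

lemma circle_fourier_coeff:
  assumes "has_power_series f a" "0 \<le> r" "r < 1"
  shows "integral {0..1} (\<lambda>t. f (of_real r * circle_pt t) * cnj (circle_pt t) ^ m) = a m * of_real r ^ m"
proof -
  have "(\<lambda>n. a n * of_real r ^ n * (if n = m then 1 else 0))
      sums integral {0..1} (\<lambda>t. f (of_real r * circle_pt t) * cnj (circle_pt t) ^ m)"
    using circle_sums[OF assms, of "\<lambda>t. cnj (circle_pt t) ^ m"]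
    by (simp add: integral_circle_pt_orthogonal continuous_intros)
  moreover have "(\<lambda>n. a n * of_real r ^ n * (if n = m then 1 else 0)) sums (a m * of_real r ^ m)"
    using sums_single[of m "\<lambda>n. a n * of_real r ^ n"] by (simp add: if_distrib cong: if_cong)
  ultimately show ?thesis by (rule sums_unique2)
qed

text \<open>With the conjugate of \<open>f\<close> as weight in \<open>circle_sums\<close>, the n-th
  integral is the conjugate of the n-th Fourier coefficient. Writing the radius as a power of
  \<open>r\<^sup>2\<close> presents the sum as a power series in \<open>r\<^sup>2\<close>.\<close>

lemma circle_parseval:
  assumes "has_power_series f a" "0 \<le> r" "r < 1"
  shows "(\<lambda>n. (norm (a n))\<^sup>2 * (r\<^sup>2) ^ n) sums integral {0..1} (\<lambda>t. (norm (f (of_real r * circle_pt t)))\<^sup>2)"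
proof -
  let ?f = "\<lambda>t. f (of_real r * circle_pt t)"
  have "integral {0..1} (\<lambda>t. circle_pt t ^ n * cnj (?f t)) = cnj (a n) * of_real r ^ n" for n
  proof -
    have "integral {0..1} (\<lambda>t. circle_pt t ^ n * cnj (?f t)) =
        cnj (integral {0..1} (\<lambda>t. ?f t * cnj (circle_pt t) ^ n))"
      by (subst integral_cnj) (simp add: mult.commute)
    thus ?thesis using circle_fourier_coeff[OF assms] by simp
  qed
  hence "(\<lambda>n. a n * of_real r ^ n * (cnj (a n) * of_real r ^ n))
      sums integral {0..1} (\<lambda>t. ?f t * cnj (?f t))"
    using circle_sums[OF assms, of "\<lambda>t. cnj (?f t)"]
    by (simp add: continuous_intros continuous_on_circle[OF assms])
  moreover have "a n * of_real r ^ n * (cnj (a n) * of_real r ^ n) =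
      of_real ((norm (a n))\<^sup>2 * (r\<^sup>2) ^ n)" for n
  proof -
    have "a n * of_real r ^ n * (cnj (a n) * of_real r ^ n) = (a n * cnj (a n)) * of_real (r ^ n * r ^ n)"
      by (simp add: mult_ac)
    thus ?thesis by (simp add: complex_norm_square[symmetric] power2_eq_square power_mult_distrib)
  qed
  moreover have "integral {0..1} (\<lambda>t. ?f t * cnj (?f t)) =
      of_real (integral {0..1} (\<lambda>t. (norm (?f t))\<^sup>2))"
  proof -
    have "(\<lambda>t. (norm (?f t))\<^sup>2) integrable_on {0..1}"
      by (intro integrable_continuous_real continuous_intros continuous_on_circle[OF assms])
    hence "((\<lambda>t. of_real ((norm (?f t))\<^sup>2)) has_integral
        (of_real (integral {0..1} (\<lambda>t. (norm (?f t))\<^sup>2)) :: complex)) {0..1}"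
      by (intro has_integral_of_real integrable_integral)
    thus ?thesis by (simp add: integral_unique complex_norm_square flip: of_real_power)
  qed
  ultimately show ?thesis by (simp only: sums_of_real_iff)
qed

text \<open>The mean of \<open>f\<close> times a positive power of \<open>circle_pt\<close>
  vanishes. Adding its conjugate to the Fourier integral for \<open>a n\<close> replaces
  \<open>f\<close> by 2 Re f, which is its own absolute value, and the mean of 2 Re f is 2 Re (a
  0).\<close>

lemma caratheodory_coeff_bound:
  assumes f: "has_power_series f a" and re: "\<And>z. z \<in> unit_disc \<Longrightarrow> Re (f z) \<ge> 0" and n: "n > 0"
  shows "norm (a n) \<le> 2 * Re (a 0)"
proof -
  have bound: "norm (a n) * r ^ n \<le> 2 * Re (a 0)" if r: "0 \<le> r" "r < 1" for r
  proof -
    let ?f = "\<lambda>t. f (of_real r * circle_pt t)" and ?c = "\<lambda>t. cnj (circle_pt t) ^ n"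
    have int: "u integrable_on {0..1}" if "continuous_on {0..1} u" for u :: "real \<Rightarrow> complex"
      using that by (rule integrable_continuous_real)
    note cont = continuous_intros continuous_on_circle[OF f r]
    have "(\<lambda>m. a m * of_real r ^ m * 0) sums integral {0..1} (\<lambda>t. ?f t * circle_pt t ^ n)"
      using circle_sums[OF f r, of "\<lambda>t. circle_pt t ^ n"] integral_circle_pt_power n
      by (simp add: continuous_intros flip: power_add)
    hence 0: "integral {0..1} (\<lambda>t. ?f t * circle_pt t ^ n) = 0"
      by (simp add: sums_iff)
    have "integral {0..1} (\<lambda>t. cnj (?f t) * ?c t) = cnj (integral {0..1} (\<lambda>t. ?f t * circle_pt t ^ n))"
      by (subst integral_cnj) simp
    hence "integral {0..1} (\<lambda>t. cnj (?f t) * ?c t) = 0" using 0 by simp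
    hence "a n * of_real r ^ n = integral {0..1} (\<lambda>t. ?f t * ?c t + cnj (?f t) * ?c t)"
      using circle_fourier_coeff[OF f r, of n]
      by (subst integral_add) (auto intro!: int cont)
    also have "norm \<dots> \<le> integral {0..1} (\<lambda>t. 2 * Re (?f t))"
    proof (rule integral_norm_bound_integral)
      show "norm (?f t * ?c t + cnj (?f t) * ?c t) \<le> 2 * Re (?f t)" for t
      proof -
        have "norm (?f t * ?c t + cnj (?f t) * ?c t) = norm (?f t + cnj (?f t))"
          by (simp add: norm_mult norm_power flip: distrib_right)
        thus ?thesis using re[OF circle_in_disc[OF r], of t] by (simp add: complex_add_cnj)
      qed
    qed (auto intro!: int cont integrable_continuous_real)
    also have "\<dots> = 2 * Re (integral {0..1} ?f)"
      by (simp add: integral_linear[OF int[OF continuous_on_circle[OF f r]] bounded_linear_Re, unfolded o_def])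
    also have "integral {0..1} ?f = a 0"
      using circle_fourier_coeff[OF f r, of 0] by simp
    finally show ?thesis using r by (simp add: norm_mult norm_power)
  qed
  \<comment> \<open>The bound holds on every smaller circle; letting \<open>r\<close> tend to 1 from
    the left removes the factor \<open>r ^ n\<close>.\<close>
  have "((\<lambda>r. norm (a n) * r ^ n) \<longlongrightarrow> norm (a n) * 1 ^ n) (at_left 1)"
    by (intro tendsto_intros)
  moreover have "eventually (\<lambda>r. norm (a n) * r ^ n \<le> 2 * Re (a 0)) (at_left 1)"
    using eventually_at_left_real[of 0 "1::real"] by (auto elim!: eventually_mono intro: bound)
  ultimately show ?thesis using tendsto_upperbound[of _ _ "at_left (1::real)"] by force
qed

subsection \<open>Coefficient sums of dominated functions\<close>

text \<open>Negative \<open>x\<close> is allowed because differentiating term by term in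
  \<open>powser_tail_le_of_diffs_le\<close> requires convergence on all of (-1,1).\<close>

lemma has_power_series_summable_abs:
  fixes x :: real
  assumes "has_power_series f a" "norm x < 1"
  shows "summable (\<lambda>n. norm (a n) * x ^ n)"
  by (rule summable_norm_cancel)
     (use has_power_series_summable[OF assms(1), of "\<bar>x\<bar>"] assms in \<open>simp add: abs_mult power_abs\<close>)

lemma has_power_series_summable_sq:
  fixes x :: real
  assumes "has_power_series f a" "norm x < 1"
  shows "summable (\<lambda>n. (norm (a n))\<^sup>2 * x ^ n)"
proof (rule summable_norm_cancel)
  have "sqrt \<bar>x\<bar> < 1" using assms by simp
  from sums_summable[OF circle_parseval[OF assms(1) _ this]]
  show "summable (\<lambda>n. norm ((norm (a n))\<^sup>2 * x ^ n))"
    by (simp add: abs_mult power_abs)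
qed

text \<open>Integrates an inequality between derivatives: the difference of the two series is
  nondecreasing on [0,x]. The constant terms \<open>u 0\<close> and \<open>v 0\<close> are its
  boundary values at 0, which is why the conclusion starts at index 1.\<close>

lemma powser_tail_le_of_diffs_le:
  fixes u v :: "nat \<Rightarrow> real"
  assumes su: "\<And>x. norm x < 1 \<Longrightarrow> summable (\<lambda>n. u n * x ^ n)"
    and sv: "\<And>x. norm x < 1 \<Longrightarrow> summable (\<lambda>n. v n * x ^ n)"
    and x: "0 \<le> x" "x < 1"
    and le: "\<And>y. 0 \<le> y \<Longrightarrow> y \<le> x \<Longrightarrow> (\<Sum>n. diffs u n * y ^ n) \<le> (\<Sum>n. diffs v n * y ^ n)"
  shows "(\<Sum>n. u (Suc n) * x ^ Suc n) \<le> (\<Sum>n. v (Suc n) * x ^ Suc n)"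
proof -
  let ?F = "\<lambda>x. (\<Sum>n. v n * x ^ n) - (\<Sum>n. u n * x ^ n)"
  have "?F 0 \<le> ?F x"
  proof (rule DERIV_nonneg_imp_nondecreasing[OF x(1)])
    fix y assume y: "0 \<le> y" "y \<le> x"
    have "(?F has_field_derivative (\<Sum>n. diffs v n * y ^ n) - (\<Sum>n. diffs u n * y ^ n)) (at y)"
      using y x by (intro derivative_intros termdiffs_strong'[where K = 1] su sv) auto
    thus "\<exists>D. (?F has_field_derivative D) (at y) \<and> 0 \<le> D"
      using le[OF y] by (intro exI conjI) auto
  qed
  moreover have "(\<Sum>n. u (Suc n) * x ^ Suc n) = (\<Sum>n. u n * x ^ n) - u 0"
    using suminf_split_head[OF su[of x]] x by simp
  moreover have "(\<Sum>n. v (Suc n) * x ^ Suc n) = (\<Sum>n. v n * x ^ n) - v 0"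
    using suminf_split_head[OF sv[of x]] x by simp
  ultimately show ?thesis by simp
qed

lemma suminf_geometric_Suc:
  fixes r :: real
  assumes "0 \<le> r" "r < 1"
  shows "summable (\<lambda>n. r ^ Suc n)" "(\<Sum>n. r ^ Suc n) = r / (1 - r)"
  using sums_mult[OF geometric_sums[of r], of r] assms by (auto simp: sums_iff)

text \<open>After a rotation \<open>c\<close> that makes \<open>w 0\<close> real and nonnegative,
  \<open>k - c * \<omega>\<close> has nonnegative real part and value \<open>k - norm (w 0)\<close>
  at 0, so Caratheodory's bound applies. Unlike the sharper Schwarz-Pick estimate, this form
  contains no division by \<open>k\<close>, which may be 0.\<close>

lemma bounded_coeff_bound:
  assumes w: "has_power_series \<omega> w" and le: "\<And>z. z \<in> unit_disc \<Longrightarrow> norm (\<omega> z) \<le> k" and n: "n > 0"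
  shows "norm (w n) \<le> 2 * (k - norm (w 0))"
proof -
  obtain c where c: "norm c = 1" "c * w 0 = of_real (norm (w 0))"
  proof (cases "w 0 = 0")
    case False
    hence "norm (cnj (sgn (w 0))) = 1" by (simp add: norm_sgn)
    moreover have "cnj (sgn (w 0)) * w 0 = of_real (norm (w 0))"
      using False by (simp add: sgn_eq complex_norm_square[symmetric] mult.commute power2_eq_square
          flip: complex_norm_square)
    ultimately show ?thesis using that by blast
  qed (use that[of 1] in auto)
  let ?p = "\<lambda>n. (if n = 0 then of_real k else 0) - c * w n"
  have "has_power_series (\<lambda>z. of_real k - c * \<omega> z) ?p"
    using w by (rule has_power_series_affine)
  moreover have "0 \<le> Re (of_real k - c * \<omega> z)" if "z \<in> unit_disc" for z
    using le[OF that] complex_Re_le_cmod[of "c * \<omega> z"] c by (simp add: norm_mult)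
  ultimately have "norm (?p n) \<le> 2 * Re (?p 0)"
    using n by (rule caratheodory_coeff_bound)
  thus ?thesis using n c by (simp add: norm_mult)
qed

lemma bohr_bound:
  assumes w: "has_power_series \<omega> w" and le: "\<And>z. z \<in> unit_disc \<Longrightarrow> norm (\<omega> z) \<le> k"
    and r: "0 \<le> r" "r \<le> 1 / 3"
  shows "(\<Sum>n. norm (w n) * r ^ n) \<le> k"
proof -
  have r1: "r < 1" using r by simp
  note sm = has_power_series_summable[OF w r(1) r1]
  have w0: "norm (w 0) \<le> k" using le[of 0] has_power_series_0[OF w] by simp
  have "(\<Sum>n. norm (w n) * r ^ n) = norm (w 0) + (\<Sum>n. norm (w (Suc n)) * r ^ Suc n)"
    using suminf_split_head[OF sm] by simp
  also have "(\<Sum>n. norm (w (Suc n)) * r ^ Suc n) \<le> (\<Sum>n. 2 * (k - norm (w 0)) * r ^ Suc n)"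
    using suminf_geometric_Suc(1)[OF r(1) r1] sm r bounded_coeff_bound[OF w le]
    by (intro suminf_le mult_right_mono summable_mult) (auto simp: summable_Suc_iff[of "\<lambda>n. norm (w n) * r ^ n", simplified])
  also have "\<dots> = 2 * (k - norm (w 0)) * (r / (1 - r))"
    using suminf_geometric_Suc[OF r(1) r1] by (subst suminf_mult) auto
  \<comment> \<open>The inequality r/(1-r) <= 1/2 is where the Bohr radius 1/3 enters; it cancels
    the factor 2 of \<open>bounded_coeff_bound\<close>.\<close>
  also have "\<dots> \<le> 2 * (k - norm (w 0)) * (1 / 2)"
    using w0 r by (intro mult_left_mono) (auto simp: field_simps)
  finally show ?thesis by (simp add: field_simps)
qed

text \<open>By the Cauchy product, the majorant series of \<open>g\<close> is at most the product of
  those of \<open>\<omega>\<close> and \<open>h\<close>, and \<open>bohr_bound\<close> estimates the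
  first factor by \<open>k\<close>.\<close>

lemma dominated_abs_sum_le:
  assumes a: "has_power_series h a" and b: "has_power_series g b"
    and \<omega>: "\<omega> holomorphic_on unit_disc" "\<And>z. z \<in> unit_disc \<Longrightarrow> norm (\<omega> z) \<le> k"
    and eq: "\<And>z. z \<in> unit_disc \<Longrightarrow> g z = \<omega> z * h z"
    and r: "0 \<le> r" "r \<le> 1 / 3"
  shows "(\<Sum>n. norm (b n) * r ^ n) \<le> k * (\<Sum>n. norm (a n) * r ^ n)"
proof -
  obtain w where w: "has_power_series \<omega> w" using holomorphic_has_power_series[OF \<omega>(1)] by blast
  have r1: "r < 1" using r by simp
  let ?A = "\<lambda>n. norm (a n) * r ^ n" and ?W = "\<lambda>n. norm (w n) * r ^ n"
  note sa = has_power_series_summable[OF a r(1) r1] and sw = has_power_series_summable[OF w r(1) r1]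
  have cauchy: "(\<lambda>n. \<Sum>i\<le>n. ?W i * ?A (n - i)) sums ((\<Sum>n. ?W n) * (\<Sum>n. ?A n))"
    using sa sw r by (intro Cauchy_product_sums) auto
  have "norm (b n) * r ^ n \<le> (\<Sum>i\<le>n. ?W i * ?A (n - i))" for n
  proof -
    have "b n = (\<Sum>i\<le>n. w i * a (n - i))"
      using eq by (rule has_power_series_mult_coeff[OF w a b])
    hence "norm (b n) \<le> (\<Sum>i\<le>n. norm (w i) * norm (a (n - i)))"
      using norm_sum[of "\<lambda>i. w i * a (n - i)" "{..n}"] by (simp add: norm_mult)
    hence "norm (b n) * r ^ n \<le> (\<Sum>i\<le>n. norm (w i) * norm (a (n - i))) * r ^ n"
      using r by (intro mult_right_mono) auto
    also have "\<dots> = (\<Sum>i\<le>n. ?W i * ?A (n - i))"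
      unfolding sum_distrib_right
    proof (rule sum.cong)
      fix i assume "i \<in> {..n}"
      hence "r ^ n = r ^ i * r ^ (n - i)" by (simp flip: power_add)
      thus "norm (w i) * norm (a (n - i)) * r ^ n = ?W i * ?A (n - i)" by simp
    qed simp
    finally show ?thesis .
  qed
  hence "(\<Sum>n. norm (b n) * r ^ n) \<le> (\<Sum>n. ?W n) * (\<Sum>n. ?A n)"
    using cauchy has_power_series_summable[OF b r(1) r1] by (metis (no_types, lifting) suminf_le sums_iff)
  also have "\<dots> \<le> k * (\<Sum>n. ?A n)"
    using r sa bohr_bound[OF w \<omega>(2) r] by (intro mult_right_mono suminf_nonneg) auto
  finally show ?thesis .
qed

text \<open>Parseval on the circle of radius \<open>sqrt x\<close> turns both sums into means, which
  are compared pointwise.\<close>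

lemma dominated_sq_sum_le:
  assumes a: "has_power_series h a" and b: "has_power_series g b"
    and le: "\<And>z. z \<in> unit_disc \<Longrightarrow> norm (g z) \<le> k * norm (h z)"
    and x: "0 \<le> x" "x < 1"
  shows "(\<Sum>n. (norm (b n))\<^sup>2 * x ^ n) \<le> k\<^sup>2 * (\<Sum>n. (norm (a n))\<^sup>2 * x ^ n)"
proof -
  define r where "r = sqrt x"
  have r: "0 \<le> r" "r < 1" and rx: "r\<^sup>2 = x" using x by (auto simp: r_def)
  have int: "(\<lambda>t. (norm (f (of_real r * circle_pt t)))\<^sup>2) integrable_on {0..1}"
    if "has_power_series f c" for f c
    by (intro integrable_continuous_real continuous_intros continuous_on_circle[OF that r])
  have "(\<Sum>n. (norm (b n))\<^sup>2 * x ^ n) = integral {0..1} (\<lambda>t. (norm (g (of_real r * circle_pt t)))\<^sup>2)"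
    using circle_parseval[OF b r] unfolding rx sums_iff by simp
  also have "\<dots> \<le> integral {0..1} (\<lambda>t. k\<^sup>2 * (norm (h (of_real r * circle_pt t)))\<^sup>2)"
    using le[OF circle_in_disc[OF r]]
    by (intro integral_le int[OF b] integrable_on_mult_right int[OF a])
       (simp add: power_mono flip: power_mult_distrib)
  also have "\<dots> = k\<^sup>2 * (\<Sum>n. (norm (a n))\<^sup>2 * x ^ n)"
    using circle_parseval[OF a r] unfolding rx sums_iff by simp
  finally show ?thesis .
qed

text \<open>The factors n + 1 are nonnegative, so the majorant series of a derivative is the
  derivative of the majorant series.\<close>

lemma diffs_norm: "diffs (\<lambda>n. norm (a n)) n = norm (diffs a n :: complex)"
  by (simp add: diffs_def norm_mult del: of_nat_Suc)

text \<open>\<open>dominated_abs_sum_le\<close> applies to the derivatives at every radius up to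
  \<open>r\<close>; integrating from 0 to \<open>r\<close> gives the claim.\<close>

lemma dominated_deriv_abs_sum_le:
  assumes a: "has_power_series h a" and b: "has_power_series g b"
    and \<omega>: "\<omega> holomorphic_on unit_disc" "\<And>z. z \<in> unit_disc \<Longrightarrow> norm (\<omega> z) \<le> k"
    and eq: "\<And>z. z \<in> unit_disc \<Longrightarrow> deriv g z = \<omega> z * deriv h z"
    and r: "0 \<le> r" "r \<le> 1 / 3"
  shows "(\<Sum>n. norm (b (Suc n)) * r ^ Suc n) \<le> k * (\<Sum>n. norm (a (Suc n)) * r ^ Suc n)"
proof -
  have sa: "summable (\<lambda>n. norm (a (Suc n)) * r ^ Suc n)"
    using has_power_series_summable[OF a r(1)] r by (subst summable_Suc_iff) auto
  have "(\<Sum>n. norm (b (Suc n)) * r ^ Suc n) \<le> (\<Sum>n. k * norm (a (Suc n)) * r ^ Suc n)"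
  proof (rule powser_tail_le_of_diffs_le)
    fix x :: real assume "norm x < 1"
    thus "summable (\<lambda>n. norm (b n) * x ^ n)" "summable (\<lambda>n. k * norm (a n) * x ^ n)"
      using summable_mult[OF has_power_series_summable_abs[OF a], of x k]
        has_power_series_summable_abs[OF b] by (auto simp: mult.assoc)
  next
    fix y assume y: "0 \<le> y" "y \<le> r"
    have "(\<Sum>n. diffs (\<lambda>n. norm (b n)) n * y ^ n) \<le> k * (\<Sum>n. diffs (\<lambda>n. norm (a n)) n * y ^ n)"
      unfolding diffs_norm
      using y r by (intro dominated_abs_sum_le[OF has_power_series_deriv[OF a] has_power_series_deriv[OF b] \<omega> eq]) auto
    also have "\<dots> = (\<Sum>n. diffs (\<lambda>n. k * norm (a n)) n * y ^ n)"
      using has_power_series_summable[OF has_power_series_deriv[OF a] y(1)] y r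
      by (subst suminf_mult[symmetric]) (auto simp: diffs_norm diffs_def[of "\<lambda>n. k * norm (a n)"] norm_mult diffs_def mult_ac simp del: of_nat_Suc)
    finally show "(\<Sum>n. diffs (\<lambda>n. norm (b n)) n * y ^ n) \<le> (\<Sum>n. diffs (\<lambda>n. k * norm (a n)) n * y ^ n)" .
  qed (use r in auto)
  also have "\<dots> = k * (\<Sum>n. norm (a (Suc n)) * r ^ Suc n)"
    using sa by (subst suminf_mult[symmetric]) (auto simp: mult_ac)
  finally show ?thesis .
qed

lemma dominated_deriv_sq_sum_le:
  assumes a: "has_power_series h a" and b: "has_power_series g b"
    and le: "\<And>z. z \<in> unit_disc \<Longrightarrow> norm (deriv g z) \<le> k * norm (deriv h z)"
    and x: "0 \<le> x" "x < 1"
  shows "(\<Sum>n. (norm (b (Suc n)))\<^sup>2 * x ^ Suc n) \<le> k\<^sup>2 * (\<Sum>n. (norm (a (Suc n)))\<^sup>2 * x ^ Suc n)"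
proof -
  define A where "A n = k\<^sup>2 * (norm (a n))\<^sup>2" for n
  define B where "B n = (norm (b n))\<^sup>2" for n
  have sA: "summable (\<lambda>n. A n * y ^ n)" and sB: "summable (\<lambda>n. B n * y ^ n)" if "norm y < 1" for y
    using summable_mult[OF has_power_series_summable_sq[OF a that], of "k\<^sup>2"]
      has_power_series_summable_sq[OF b that] by (auto simp: A_def B_def mult.assoc)
  have sdA: "summable (\<lambda>n. diffs A n * y ^ n)" and sdB: "summable (\<lambda>n. diffs B n * y ^ n)"
    if "norm y < 1" for y
    by (intro termdiff_converges[OF that] sA sB; assumption)+
  \<comment> \<open>\<open>n * B n\<close> are the coefficients of \<open>y * B' y\<close>, whose derivative has coefficients
    \<open>(n + 1)\<^sup>2 * B (n + 1)\<close>, the squared coefficients of \<open>deriv g\<close>; so Parseval for the derivatives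
    is integrated twice.\<close>
  have shift: "(\<Sum>n. real (Suc n) * C (Suc n) * y ^ Suc n) = y * (\<Sum>n. diffs C n * y ^ n)"
    "summable (\<lambda>n. real n * C n * y ^ n)"
    if "summable (\<lambda>n. diffs C n * y ^ n)" for C :: "nat \<Rightarrow> real" and y
  proof -
    have *: "real (Suc n) * C (Suc n) * y ^ Suc n = y * (diffs C n * y ^ n)" for n
      by (simp add: diffs_def)
    show "(\<Sum>n. real (Suc n) * C (Suc n) * y ^ Suc n) = y * (\<Sum>n. diffs C n * y ^ n)"
      unfolding * by (rule suminf_mult[OF that])
    have "summable (\<lambda>n. real (Suc n) * C (Suc n) * y ^ Suc n)"
      unfolding * by (rule summable_mult[OF that])
    thus "summable (\<lambda>n. real n * C n * y ^ n)" by (subst (asm) summable_Suc_iff)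
  qed
  have first: "(\<Sum>n. diffs (\<lambda>n. real n * B n) n * y ^ n) \<le> (\<Sum>n. diffs (\<lambda>n. real n * A n) n * y ^ n)"
    if y: "0 \<le> y" "y < 1" for y
  proof -
    have B: "diffs (\<lambda>n. real n * B n) n = (norm (diffs b n))\<^sup>2" for n
      by (simp add: diffs_def B_def norm_mult power_mult_distrib power2_eq_square del: of_nat_Suc)
    have A: "diffs (\<lambda>n. real n * A n) n = k\<^sup>2 * (norm (diffs a n))\<^sup>2" for n
      by (simp add: diffs_def A_def norm_mult power_mult_distrib power2_eq_square del: of_nat_Suc)
    have "summable (\<lambda>n. (norm (diffs a n))\<^sup>2 * y ^ n)"
      using has_power_series_summable_sq[OF has_power_series_deriv[OF a], of y] y by simp
    hence "(\<Sum>n. k\<^sup>2 * (norm (diffs a n))\<^sup>2 * y ^ n) = k\<^sup>2 * (\<Sum>n. (norm (diffs a n))\<^sup>2 * y ^ n)"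
      by (subst suminf_mult[symmetric]) (auto simp: mult.assoc)
    thus ?thesis unfolding A B
      using dominated_sq_sum_le[OF has_power_series_deriv[OF a] has_power_series_deriv[OF b] le y] by simp
  qed
  have second: "y * (\<Sum>n. diffs B n * y ^ n) \<le> y * (\<Sum>n. diffs A n * y ^ n)" if y: "0 \<le> y" "y < 1" for y
  proof -
    have "norm y < 1" using y by simp
    have "(\<Sum>n. real (Suc n) * B (Suc n) * y ^ Suc n) \<le> (\<Sum>n. real (Suc n) * A (Suc n) * y ^ Suc n)"
      by (rule powser_tail_le_of_diffs_le[OF _ _ y first]) (use y in \<open>auto intro!: shift(2) sdA sdB\<close>)
    thus ?thesis using shift(1) sdA sdB \<open>norm y < 1\<close> by simp
  qed
  have "(\<Sum>n. B (Suc n) * x ^ Suc n) \<le> (\<Sum>n. A (Suc n) * x ^ Suc n)"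
  proof (rule powser_tail_le_of_diffs_le[OF sB sA x])
    fix y assume y: "0 \<le> y" "y \<le> x"
    show "(\<Sum>n. diffs B n * y ^ n) \<le> (\<Sum>n. diffs A n * y ^ n)"
    \<comment> \<open>The factor \<open>y\<close> in \<open>second\<close> cancels only for positive
      \<open>y\<close>. At 0 only the constant coefficients of the derivatives remain, and Parseval
      for the derivatives at radius 0 compares them.\<close>
    proof (cases "y = 0")
      case True
      have "(\<Sum>n. (norm (diffs b n))\<^sup>2 * 0 ^ n) \<le> k\<^sup>2 * (\<Sum>n. (norm (diffs a n))\<^sup>2 * 0 ^ n)"
        by (rule dominated_sq_sum_le[OF has_power_series_deriv[OF a] has_power_series_deriv[OF b] le]) auto
      thus ?thesis using True by (simp add: powser_zero diffs_def A_def B_def)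
    next
      case False
      thus ?thesis using second[of y] y x by simp
    qed
  qed
  also have "(\<Sum>n. A (Suc n) * x ^ Suc n) = k\<^sup>2 * (\<Sum>n. (norm (a (Suc n)))\<^sup>2 * x ^ Suc n)"
  proof -
    have "summable (\<lambda>n. (norm (a (Suc n)))\<^sup>2 * x ^ Suc n)"
      using has_power_series_summable_sq[OF a, of x] x by (subst summable_Suc_iff) auto
    thus ?thesis unfolding A_def by (subst suminf_mult[symmetric]) (auto simp: mult.assoc)
  qed
  finally show ?thesis by (simp add: B_def)
qed

subsection \<open>Functions subordinate to a convex function\<close>

text \<open>Otherwise the inverse of \<open>f\<close> would be a bounded entire function, hence
  constant by Liouville. The lemma ensures that the image has a frontier point.\<close>

lemma univalent_image_ne_UNIV:
  assumes "f holomorphic_on unit_disc" "inj_on f unit_disc"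
  shows "f ` unit_disc \<noteq> UNIV"
proof
  assume U: "f ` unit_disc = UNIV"
  obtain g where g: "g holomorphic_on f ` unit_disc" "\<And>z. z \<in> unit_disc \<Longrightarrow> g (f z) = z"
    using holomorphic_has_inverse[OF assms(1) open_ball assms(2)] by metis
  have "range g \<subseteq> unit_disc"
  proof
    fix y assume "y \<in> range g"
    then obtain x where "y = g x" by blast
    moreover obtain z where "z \<in> unit_disc" "x = f z" using U by blast
    ultimately show "y \<in> unit_disc" using g(2) by simp
  qed
  hence "bounded (range g)" using bounded_subset bounded_ball by blast
  hence "g constant_on UNIV" using Liouville_theorem g(1) unfolding U by blast
  then obtain c where "\<And>x. g x = c" unfolding constant_on_def by blast
  hence "c = 0" "c = 1 / 2" using g(2)[of 0] g(2)[of "1/2"] by auto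
  thus False by simp
qed

text \<open>A supporting line is taken at a frontier point \<open>y\<close> nearest to
  \<open>\<phi> 0\<close>. By Cauchy-Schwarz its distance from \<open>\<phi> 0\<close> is at most
  the distance to \<open>y\<close>, which is \<open>boundary_dist \<phi>\<close>.\<close>

lemma univalent_convex_supporting_line:
  assumes "univalent_convex \<phi>"
  obtains c where "norm c = 1" "\<And>z. z \<in> unit_disc \<Longrightarrow> Re (c * (\<phi> z - \<phi> 0)) \<le> boundary_dist \<phi>"
proof -
  let ?S = "\<phi> ` unit_disc"
  have \<phi>: "\<phi> holomorphic_on unit_disc" "inj_on \<phi> unit_disc" "convex ?S"
    using assms by (auto simp: univalent_convex_def)
  have "open ?S" using open_mapping_thm3[OF \<phi>(1) open_ball \<phi>(2)] .
  have ne: "frontier ?S \<noteq> {}"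
    using univalent_image_ne_UNIV[OF \<phi>(1,2)] by (simp add: frontier_eq_empty)
  obtain y where y: "y \<in> frontier ?S" "infdist (\<phi> 0) (frontier ?S) = dist (\<phi> 0) y"
    using infdist_attains_inf[OF frontier_closed ne] by blast
  have "closure ?S \<noteq> {}" "y \<in> closure ?S" using y by (auto simp: frontier_def)
  \<comment> \<open>An open convex set is the relative interior of its closure, so the frontier
    point \<open>y\<close> lies outside it, as the supporting hyperplane theorem demands.\<close>
  moreover have "y \<notin> rel_interior (closure ?S)"
  proof -
    have "interior ?S = ?S" using \<open>open ?S\<close> by (rule interior_open)
    moreover have "rel_interior (closure ?S) = ?S"
      unfolding convex_rel_interior_closure[OF \<phi>(3)] using \<open>open ?S\<close> by (rule rel_interior_open)
    ultimately show ?thesis using y unfolding frontier_def by simp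
  qed
  ultimately obtain a where a: "a \<noteq> 0" "\<And>x. x \<in> closure ?S \<Longrightarrow> a \<bullet> y \<le> a \<bullet> x"
    using supporting_hyperplane_rel_boundary[OF convex_closure[OF \<phi>(3)], of y] by metis
  \<comment> \<open>The real inner product of \<open>sgn a\<close> with \<open>v\<close> is Re (cnj
    (sgn a) * v). The minus sign turns the lower bound over the closure into an upper bound.\<close>
  define c where "c = - cnj (sgn a)"
  have "norm c = 1" using a(1) by (simp add: c_def norm_sgn)
  moreover have "Re (c * (\<phi> z - \<phi> 0)) \<le> boundary_dist \<phi>" if z: "z \<in> unit_disc" for z
  proof -
    have "\<phi> z \<in> closure ?S" by (intro subsetD[OF closure_subset] imageI z)
    hence "a \<bullet> (\<phi> 0 - \<phi> z) \<le> a \<bullet> (\<phi> 0 - y)"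
      using a(2) by (simp add: inner_diff_right)
    hence "sgn a \<bullet> (\<phi> 0 - \<phi> z) \<le> sgn a \<bullet> (\<phi> 0 - y)"
      by (simp add: sgn_div_norm divide_right_mono mult_left_mono)
    also have "\<dots> \<le> norm (sgn a) * norm (\<phi> 0 - y)" by (rule norm_cauchy_schwarz)
    also have "\<dots> = boundary_dist \<phi>"
      using a(1) y(2) by (simp add: norm_sgn boundary_dist_def dist_norm)
    also have "sgn a \<bullet> (\<phi> 0 - \<phi> z) = Re (c * (\<phi> z - \<phi> 0))"
      by (simp add: c_def inner_complex_def algebra_simps)
    finally show ?thesis .
  qed
  ultimately show ?thesis using that by blast
qed

text \<open>Since \<open>h\<close> takes values in the image of \<open>\<phi>\<close> and
  \<open>h 0 = \<phi> 0\<close>, the supporting line shows that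
  \<open>boundary_dist \<phi> - c * (h z - h 0)\<close> has nonnegative real part. Its value at 0 is
  \<open>boundary_dist \<phi>\<close>, and Caratheodory's bound applies.\<close>

lemma convex_subordinate_coeff_bound:
  assumes h: "has_power_series h a" and \<phi>: "univalent_convex \<phi>" "subordinate h \<phi>" and n: "n > 0"
  shows "norm (a n) \<le> 2 * boundary_dist \<phi>"
proof -
  let ?l = "boundary_dist \<phi>"
  obtain w where w: "w ` unit_disc \<subseteq> unit_disc" "w 0 = 0" "\<And>z. z \<in> unit_disc \<Longrightarrow> h z = \<phi> (w z)"
    using \<phi>(2) unfolding subordinate_def by blast
  have a0: "a 0 = \<phi> 0" using has_power_series_0[OF h] w(2) w(3)[of 0] by simp
  obtain c where c: "norm c = 1" "\<And>z. z \<in> unit_disc \<Longrightarrow> Re (c * (\<phi> z - \<phi> 0)) \<le> ?l"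
    using univalent_convex_supporting_line[OF \<phi>(1)] by blast
  let ?p = "\<lambda>n. (if n = 0 then of_real ?l + c * a 0 else 0) - c * a n"
  have "has_power_series (\<lambda>z. of_real ?l + c * a 0 - c * h z) ?p"
    using h by (rule has_power_series_affine)
  moreover have "0 \<le> Re (of_real ?l + c * a 0 - c * h z)" if "z \<in> unit_disc" for z
  proof -
    have "w z \<in> unit_disc" using w(1) that by blast
    thus ?thesis using c(2)[of "w z"] w(3)[OF that] a0 by (simp add: algebra_simps)
  qed
  ultimately have "norm (?p n) \<le> 2 * Re (?p 0)"
    using n by (rule caratheodory_coeff_bound)
  thus ?thesis using n c by (simp add: norm_mult)
qed

subsection \<open>The majorant\<close>

text \<open>An upper bound for S1/l: inserting \<open>2 * l\<close> for each |a_n| and adding the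
  shares \<open>k\<close> and \<open>k\<^sup>2\<close> of the coefficients of \<open>g\<close> gives
  geometric sums, from which one factor \<open>l\<close> is divided out. The quadratic part
  therefore keeps a factor \<open>l\<close>.\<close>

definition majorant :: "real \<Rightarrow> real \<Rightarrow> real \<Rightarrow> real" where
  "majorant k l r = 2 * (1 + k) * (r / (1 - r)) +
     4 * (1 + k\<^sup>2) * l * (r\<^sup>2 / (1 - r\<^sup>2)) * (1 / (2 - l) + r / (1 - r))"

lemma G1_eq_majorant:
  assumes "0 \<le> r" "r < 1" "l < 2"
  shows "G1 k l r = (2 - l) * (1 - r) * (1 - r\<^sup>2) * (1 - majorant k l r)"
proof -
  have nz: "1 - r \<noteq> 0" "2 - l \<noteq> 0" "1 + r \<noteq> 0" using assms by auto
  have sq: "1 - r\<^sup>2 = (1 - r) * (1 + r)" by (simp add: power2_eq_square algebra_simps)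
  show ?thesis
    using nz unfolding G1_def majorant_def sq
    by (simp add: divide_simps) (simp add: algebra_simps power2_eq_square power3_eq_cube)
qed

lemma G1_sign:
  assumes "0 \<le> r" "r < 1" "l < 2"
  shows "G1 k l r = 0 \<longleftrightarrow> majorant k l r = 1" "G1 k l r < 0 \<longleftrightarrow> majorant k l r > 1"
proof -
  have "r\<^sup>2 < 1" using assms by (simp add: power_less_one_iff)
  hence "(2 - l) * (1 - r) * (1 - r\<^sup>2) > 0" using assms by simp
  thus "G1 k l r = 0 \<longleftrightarrow> majorant k l r = 1" "G1 k l r < 0 \<longleftrightarrow> majorant k l r > 1"
    unfolding G1_eq_majorant[OF assms] using assms by (auto simp: mult_less_0_iff zero_less_mult_iff)
qed

lemma majorant_mono:
  assumes "0 \<le> k" "0 \<le> l" "l \<le> l'" "l' \<le> 1" "0 \<le> r" "r \<le> r'" "r' < 1"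
  shows "majorant k l r \<le> majorant k l' r'"
proof -
  have r2: "r\<^sup>2 \<le> r'\<^sup>2" "r'\<^sup>2 < 1" "r\<^sup>2 \<le> 1"
    using assms by (auto intro: power_mono power_le_one simp: power_less_one_iff)
  have "r / (1 - r) \<le> r' / (1 - r')" "r\<^sup>2 / (1 - r\<^sup>2) \<le> r'\<^sup>2 / (1 - r'\<^sup>2)" "1 / (2 - l) \<le> 1 / (2 - l')"
    using assms r2 by (auto intro!: frac_le)
  thus ?thesis unfolding majorant_def
    using assms r2 by (intro add_mono mult_mono) (auto intro!: mult_nonneg_nonneg divide_nonneg_nonneg add_nonneg_nonneg)
qed

text \<open>Strictness comes from the first summand alone, since the second one vanishes for
  \<open>l = 0\<close>.\<close>

lemma majorant_strict_mono_radius: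
  assumes "0 \<le> k" "0 \<le> l" "l \<le> 1" "0 \<le> r" "r < r'" "r' < 1"
  shows "majorant k l r < majorant k l r'"
proof -
  have r2: "r\<^sup>2 \<le> r'\<^sup>2" "r'\<^sup>2 < 1" "r\<^sup>2 \<le> 1"
    using assms by (auto intro: power_mono power_le_one simp: power_less_one_iff)
  have lt: "r / (1 - r) < r' / (1 - r')" and "r\<^sup>2 / (1 - r\<^sup>2) \<le> r'\<^sup>2 / (1 - r'\<^sup>2)"
    using assms r2 by (auto intro!: frac_less frac_le)
  hence "4 * (1 + k\<^sup>2) * l * (r\<^sup>2 / (1 - r\<^sup>2)) * (1 / (2 - l) + r / (1 - r)) \<le>
      4 * (1 + k\<^sup>2) * l * (r'\<^sup>2 / (1 - r'\<^sup>2)) * (1 / (2 - l) + r' / (1 - r'))"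
    using assms r2 by (intro add_mono mult_mono) (auto intro!: mult_nonneg_nonneg divide_nonneg_nonneg add_nonneg_nonneg)
  moreover have "2 * (1 + k) * (r / (1 - r)) < 2 * (1 + k) * (r' / (1 - r'))"
    using lt assms by (intro mult_strict_left_mono) auto
  ultimately show ?thesis unfolding majorant_def by linarith
qed

text \<open>Here \<open>r\<close> must be positive: at \<open>r = 0\<close> the majorant does not
  depend on \<open>l\<close>.\<close>

lemma majorant_strict_mono_dist:
  assumes "0 \<le> k" "0 \<le> l" "l < l'" "l' \<le> 1" "0 < r" "r < 1"
  shows "majorant k l r < majorant k l' r"
proof -
  have r2: "0 < r\<^sup>2" "r\<^sup>2 < 1" using assms by (auto simp: power_less_one_iff)
  have "1 / (2 - l) \<le> 1 / (2 - l')" using assms by (auto intro!: frac_le)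
  moreover have "4 * (1 + k\<^sup>2) * (r\<^sup>2 / (1 - r\<^sup>2)) > 0" using r2 by (intro mult_pos_pos divide_pos_pos add_pos_nonneg) auto
  hence "4 * (1 + k\<^sup>2) * (r\<^sup>2 / (1 - r\<^sup>2)) * l < 4 * (1 + k\<^sup>2) * (r\<^sup>2 / (1 - r\<^sup>2)) * l'"
    using assms by (intro mult_strict_left_mono) auto
  hence "4 * (1 + k\<^sup>2) * l * (r\<^sup>2 / (1 - r\<^sup>2)) < 4 * (1 + k\<^sup>2) * l' * (r\<^sup>2 / (1 - r\<^sup>2))"
    by (simp only: mult_ac)
  moreover have "0 \<le> 4 * (1 + k\<^sup>2) * l * (r\<^sup>2 / (1 - r\<^sup>2))" using assms r2 by simp
  moreover have "0 < 1 / (2 - l) + r / (1 - r)" using assms by (intro add_pos_pos) auto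
  ultimately show ?thesis unfolding majorant_def
    by (intro add_strict_left_mono, elim mult_less_le_imp_less) auto
qed

lemma S1_le_majorant:
  assumes K: "K \<ge> 1" and k: "k = (K - 1) / (K + 1)"
    and adm: "admissible K f h g a b \<phi>" and r: "0 \<le> r" "r \<le> 1 / 3"
  shows "S1 a b (boundary_dist \<phi>) r \<le> boundary_dist \<phi> * majorant k (boundary_dist \<phi>) r"
proof -
  define l where "l = boundary_dist \<phi>"
  have l: "0 \<le> l" "l \<le> 1" using adm by (auto simp: l_def boundary_dist_def infdist_nonneg admissible_def)
  have r1: "r < 1" and r2: "0 \<le> r\<^sup>2" "r\<^sup>2 < 1" using r by (auto simp: power_less_one_iff)
  have k0: "0 \<le> k" using K k by simp
  have h: "has_power_series h a" and g: "has_power_series g b"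
    and hg: "h holomorphic_on unit_disc" "g holomorphic_on unit_disc"
    and h': "\<And>z. z \<in> unit_disc \<Longrightarrow> deriv h z \<noteq> 0"
    and \<omega>: "\<And>z. z \<in> unit_disc \<Longrightarrow> norm (dilatation h g z) \<le> k"
    and \<phi>: "univalent_convex \<phi>" "subordinate h \<phi>"
    using adm k by (auto simp: admissible_def qc_harmonic_mapping_def harmonic_mapping_def sense_preserving_def)
  have \<omega>_hol: "dilatation h g holomorphic_on unit_disc"
    using h' hg unfolding dilatation_def[abs_def] by (intro holomorphic_intros) auto
  have eq: "deriv g z = dilatation h g z * deriv h z" if "z \<in> unit_disc" for z
    using h'[OF that] by (simp add: dilatation_def)
  have le: "norm (deriv g z) \<le> k * norm (deriv h z)" if "z \<in> unit_disc" for z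
    using \<omega>[OF that] by (simp add: eq[OF that] norm_mult mult_right_mono)
  have a: "norm (a (Suc n)) \<le> 2 * l" for n
    unfolding l_def by (intro convex_subordinate_coeff_bound[OF h \<phi>]) simp
  let ?A = "\<Sum>n. norm (a (Suc n)) * r ^ Suc n" and ?B = "\<Sum>n. norm (b (Suc n)) * r ^ Suc n"
  \<comment> \<open>The squares are written as power series in \<open>r\<^sup>2\<close> to fit the
    Parseval estimates; \<open>power_mult\<close> matches them with \<open>S1\<close> at the
    end.\<close>
  let ?A2 = "\<Sum>n. (norm (a (Suc n)))\<^sup>2 * (r\<^sup>2) ^ Suc n" and ?B2 = "\<Sum>n. (norm (b (Suc n)))\<^sup>2 * (r\<^sup>2) ^ Suc n"
  have A: "?A \<le> 2 * l * (r / (1 - r))"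
  proof -
    have "?A \<le> (\<Sum>n. 2 * l * r ^ Suc n)"
    proof (rule suminf_le)
      show "summable (\<lambda>n. norm (a (Suc n)) * r ^ Suc n)"
        using has_power_series_summable[OF h r(1) r1] by (subst summable_Suc_iff)
      show "summable (\<lambda>n. 2 * l * r ^ Suc n)"
        by (intro summable_mult suminf_geometric_Suc r r1)
      show "norm (a (Suc n)) * r ^ Suc n \<le> 2 * l * r ^ Suc n" for n
        using a[of n] r by (intro mult_right_mono) auto
    qed
    thus ?thesis using suminf_geometric_Suc[OF r(1) r1] by (simp only: suminf_mult)
  qed
  have A2: "?A2 \<le> 4 * l\<^sup>2 * (r\<^sup>2 / (1 - r\<^sup>2))"
  proof -
    have "?A2 \<le> (\<Sum>n. 4 * l\<^sup>2 * (r\<^sup>2) ^ Suc n)"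
    proof (rule suminf_le)
      show "summable (\<lambda>n. (norm (a (Suc n)))\<^sup>2 * (r\<^sup>2) ^ Suc n)"
        using has_power_series_summable_sq[OF h, of "r\<^sup>2"] r2 by (subst summable_Suc_iff) auto
      show "summable (\<lambda>n. 4 * l\<^sup>2 * (r\<^sup>2) ^ Suc n)"
        by (intro summable_mult suminf_geometric_Suc r2)
      show "(norm (a (Suc n)))\<^sup>2 * (r\<^sup>2) ^ Suc n \<le> 4 * l\<^sup>2 * (r\<^sup>2) ^ Suc n" for n
        using power_mono[OF a[of n], of 2] r by (intro mult_right_mono) (auto simp: power_mult_distrib)
    qed
    thus ?thesis using suminf_geometric_Suc[OF r2] by (simp only: suminf_mult)
  qed
  have B: "?B \<le> k * ?A"
    using \<omega> eq by (intro dominated_deriv_abs_sum_le[OF h g \<omega>_hol _ _ r]) auto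
  have B2: "?B2 \<le> k\<^sup>2 * ?A2"
    using le by (intro dominated_deriv_sq_sum_le[OF h g _ r2]) auto
  have sum1: "?A + ?B \<le> (1 + k) * (2 * l * (r / (1 - r)))"
    using B mult_left_mono[OF A k0] A unfolding distrib_right mult_1 by linarith
  have sum2: "(1 / (2 - l) + r / (1 - r)) * (?A2 + ?B2) \<le>
      (1 / (2 - l) + r / (1 - r)) * ((1 + k\<^sup>2) * (4 * l\<^sup>2 * (r\<^sup>2 / (1 - r\<^sup>2))))"
  proof (rule mult_left_mono)
    have "k\<^sup>2 * ?A2 \<le> k\<^sup>2 * (4 * l\<^sup>2 * (r\<^sup>2 / (1 - r\<^sup>2)))" by (rule mult_left_mono[OF A2]) simp
    thus "?A2 + ?B2 \<le> (1 + k\<^sup>2) * (4 * l\<^sup>2 * (r\<^sup>2 / (1 - r\<^sup>2)))"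
      using A2 B2 unfolding distrib_right mult_1 by linarith
    show "0 \<le> 1 / (2 - l) + r / (1 - r)" using l r by simp
  qed
  have "(1 + k) * (2 * l * X) + Z * ((1 + k\<^sup>2) * (4 * l\<^sup>2 * Y)) =
      l * (2 * (1 + k) * X + 4 * (1 + k\<^sup>2) * l * Y * Z)" for X Y Z
    by (simp add: algebra_simps power2_eq_square)
  from add_mono[OF sum1 sum2, unfolded this] show ?thesis
    unfolding S1_def l_def[symmetric] power_mult majorant_def .
qed

section \<open>The radius r0 and the distance threshold as level sets of the majorant\<close>

theorem theorem3p1:
  fixes K k :: real
  assumes "K \<ge> 1" and "k = (K - 1) / (K + 1)"
  shows "(\<exists>!r0. is_r0 K r0) \<and>
    (\<forall>r0. is_r0 K r0 \<longrightarrow>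
      (\<forall>f h g a b \<phi> r. admissible K f h g a b \<phi> \<longrightarrow> 0 \<le> r \<longrightarrow> r \<le> r0 \<longrightarrow>
         S1 a b (boundary_dist \<phi>) r \<le> boundary_dist \<phi>) \<and>
      (\<forall>r. r0 < r \<and> r < (K + 1) / (5 * K + 1) \<longrightarrow>
         (\<exists>!l1. 0 < l1 \<and> l1 < 1 \<and> G1 k l1 r = 0) \<and>
         (\<forall>l1. 0 < l1 \<and> l1 < 1 \<and> G1 k l1 r = 0 \<longrightarrow>
            (\<forall>f h g a b \<phi>. admissible K f h g a b \<phi> \<longrightarrow> boundary_dist \<phi> \<le> l1 \<longrightarrow>
               S1 a b (boundary_dist \<phi>) r \<le> boundary_dist \<phi>))))"
proof -
  define R where "R = (K + 1) / (5 * K + 1)"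
  have k0: "0 \<le> k" using assms by simp
  have R: "0 < R" "R \<le> 1 / 3" using assms by (auto simp: R_def field_simps)
  \<comment> \<open>Thus \<open>R\<close> is 1/(3 + 2k), the radius at which the majorant for
    \<open>l = 0\<close> equals 1.\<close>
  have R_eq: "(3 + 2 * k) * R = 1" using assms by (simp add: R_def divide_simps) (simp add: algebra_simps)
  have r0_iff: "is_r0 K r \<longleftrightarrow> 0 < r \<and> r < R \<and> majorant k 1 r = 1" for r
  proof -
    have "is_r0 K r \<longleftrightarrow> 0 < r \<and> r < R \<and> G1 k 1 r = 0"
      unfolding is_r0_def R_def assms(2)[symmetric] G1_def by (simp add: algebra_simps)
    thus ?thesis using G1_sign(1)[of r 1 k] R by auto
  qed
  have S1_le: "S1 a b (boundary_dist \<phi>) r \<le> boundary_dist \<phi>"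
    if "admissible K f h g a b \<phi>" "0 \<le> r" "r \<le> R" "majorant k (boundary_dist \<phi>) r \<le> 1"
    for f h g a b \<phi> r
  proof -
    have "boundary_dist \<phi> * majorant k (boundary_dist \<phi>) r \<le> boundary_dist \<phi> * 1"
      using that(4) by (intro mult_left_mono) (auto simp: boundary_dist_def infdist_nonneg)
    thus ?thesis using S1_le_majorant[OF assms that(1,2)] that R by simp
  qed
  have dist: "0 \<le> boundary_dist \<phi>" "boundary_dist \<phi> \<le> 1" if "admissible K f h g a b \<phi>" for f h g a b \<phi>
    using that by (auto simp: admissible_def boundary_dist_def infdist_nonneg)
  have "\<exists>r0. 0 < r0 \<and> r0 < R \<and> majorant k 1 r0 = 1"
  proof -
    \<comment> \<open>These multiples of \<open>R_eq\<close> eliminate the cubic and linear terms of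
      \<open>G1 k 1 R\<close>, leaving a negative multiple of \<open>R\<^sup>2\<close>.\<close>
    have "R * ((3 + 2 * k) * R) = R" "R\<^sup>2 * ((3 + 2 * k) * R) = R\<^sup>2" using R_eq by simp_all
    hence "G1 k 1 R = - (4 * (1 + k\<^sup>2) * R\<^sup>2)"
      using R_eq unfolding G1_def by (simp add: algebra_simps power2_eq_square power3_eq_cube)
    moreover have "0 < 4 * (1 + k\<^sup>2) * R\<^sup>2" using R by (intro mult_pos_pos add_pos_nonneg) auto
    ultimately have neg: "G1 k 1 R < 0" by simp
    have pos: "G1 k 1 0 > 0" by (simp add: G1_def)
    have "continuous_on {0..R} (G1 k 1)" unfolding G1_def[abs_def] by (intro continuous_intros)
    then obtain r where r: "0 \<le> r" "r \<le> R" "G1 k 1 r = 0"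
      using IVT2'[of "G1 k 1" R 0 0] neg pos R by auto
    hence "r \<noteq> 0" "r \<noteq> R" using neg pos by auto
    thus ?thesis using r R G1_sign(1)[of r 1 k] by (intro exI[of _ r]) auto
  qed
  moreover have "r = r'" if "0 < r" "r < R" "majorant k 1 r = 1" "0 < r'" "r' < R" "majorant k 1 r' = 1" for r r'
    using that majorant_strict_mono_radius[OF k0, of 1 r r'] majorant_strict_mono_radius[OF k0, of 1 r' r] R
    by (cases r r' rule: linorder_cases) auto
  ultimately have ex_r0: "\<exists>!r0. is_r0 K r0" unfolding r0_iff by blast
  have small: "S1 a b (boundary_dist \<phi>) r \<le> boundary_dist \<phi>"
    if r0: "is_r0 K r0" and adm: "admissible K f h g a b \<phi>" and r: "0 \<le> r" "r \<le> r0" for r0 f h g a b \<phi> r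
  proof (rule S1_le[OF adm r(1)])
    \<comment> \<open>The worst case is distance 1 and radius \<open>r0\<close>, where the majorant
      equals 1.\<close>
    show "r \<le> R" "majorant k (boundary_dist \<phi>) r \<le> 1"
      using majorant_mono[OF k0 dist(1)[OF adm] dist(2)[OF adm] _ r] r0 r R unfolding r0_iff by auto
  qed
  have ex_l1: "\<exists>!l1. 0 < l1 \<and> l1 < 1 \<and> G1 k l1 r = 0" if r0: "is_r0 K r0" and r: "r0 < r" "r < R" for r0 r
  proof -
    have rr: "0 < r" "r < 1" using r r0 R unfolding r0_iff by auto
    \<comment> \<open>Beyond \<open>r0\<close> the majorant at distance 1 exceeds 1, so
      \<open>G1\<close> is negative at \<open>l = 1\<close>. Positivity at \<open>l = 0\<close> then
      gives a root in between.\<close>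
    have "majorant k 1 r > 1"
      using majorant_strict_mono_radius[OF k0, of 1 r0 r] r0 r rr unfolding r0_iff by auto
    hence neg: "G1 k 1 r < 0" using G1_sign(2)[of r 1 k] rr by simp
    \<comment> \<open>At \<open>l = 0\<close> the polynomial \<open>G1\<close> factors, and its sign
      is that of 1 - (3 + 2k) r, positive to the left of \<open>R\<close>.\<close>
    have "(3 + 2 * k) * r < 1" using mult_strict_left_mono[OF r(2), of "3 + 2 * k"] R_eq k0 by simp
    moreover have "r\<^sup>2 < 1" using rr by (simp add: power_less_one_iff)
    ultimately have "0 < 2 * (1 - r\<^sup>2) * (1 - (3 + 2 * k) * r)" by simp
    also have "\<dots> = G1 k 0 r" by (simp add: G1_def algebra_simps power2_eq_square power3_eq_cube)
    finally have pos: "G1 k 0 r > 0" .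
    have "continuous_on {0..1} (\<lambda>l. G1 k l r)" unfolding G1_def by (intro continuous_intros)
    then obtain l where l: "0 \<le> l" "l \<le> 1" "G1 k l r = 0"
      using IVT2'[of "\<lambda>l. G1 k l r" 1 0 0] neg pos by auto
    hence "l \<noteq> 0" "l \<noteq> 1" using neg pos by auto
    hence "\<exists>l. 0 < l \<and> l < 1 \<and> G1 k l r = 0" using l by (intro exI[of _ l]) auto
    \<comment> \<open>\<open>G1\<close> is quadratic in \<open>l\<close>; strict monotonicity of the
      majorant in \<open>l\<close> leaves only one root in (0,1).\<close>
    moreover have "l = l'" if "0 < l" "l < 1" "G1 k l r = 0" "0 < l'" "l' < 1" "G1 k l' r = 0" for l l'
      using that rr majorant_strict_mono_dist[OF k0, of l l' r] majorant_strict_mono_dist[OF k0, of l' l r]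
        G1_sign(1)[of r l k] G1_sign(1)[of r l' k]
      by (cases l l' rule: linorder_cases) auto
    ultimately show ?thesis by blast
  qed
  have large: "S1 a b (boundary_dist \<phi>) r \<le> boundary_dist \<phi>"
    if r0: "is_r0 K r0" and r: "r0 < r" "r < R" and l: "0 < l1" "l1 < 1" "G1 k l1 r = 0"
      and adm: "admissible K f h g a b \<phi>" and le: "boundary_dist \<phi> \<le> l1" for r0 r l1 f h g a b \<phi>
  proof -
    have rr: "0 < r" "r < 1" using r r0 R unfolding r0_iff by auto
    have "majorant k (boundary_dist \<phi>) r \<le> majorant k l1 r"
      using majorant_mono[OF k0 dist(1)[OF adm] le, of r r] rr l by simp
    also have "\<dots> = 1" using G1_sign(1)[of r l1 k] rr l by simp
    finally show ?thesis using S1_le[OF adm, of r] rr r by simp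
  qed
  show ?thesis unfolding R_def[symmetric]
    by (intro conjI allI impI; (elim conjE)?) (rule ex_r0 | erule (3) small | erule (2) ex_l1 | erule (7) large)+
qed

end
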